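(* Let $F:X\to(-\infty,+\infty]$ and $G^\ast:Y\to(-\infty,+\infty]$ be proper, convex and lower semicontinuous; let $K:X\times W\to Y$ be $C^1$ with $K(\cdot,w)$ linear for every $w\in W$ and $K(x,\cdot)$ affine for every $x\in X$; and suppose that for every $w\in W$ the saddle problem $\min_x\max_y\mathcal L(x,y,w)$ admits at least one saddle point. Suppose further that there are $w^\star\in W$ and a saddle point $z^\star=(x^\star,y^\star)$ of the problem at $w^\star$ such that $F$ and $G^\ast$ are finite and $C^2$ in neighborhoods of $x^\star$ and $y^\star$, respectively, $(w,z)\mapsto\mathcal A_w(z)$ is $C^1$ in a neighborhood of $(w^\star,z^\star)$, and $D_z\mathcal A_{w^\star}(z^\star):Z\to Z$ is an isomorphism. Let $U_{w^*}\subset W$ and $U_{z^*}\subset Z$ be the open bounded convex neighborhoods (balls) of $w^\star$ and $z^\star$, $w\mapsto z^\star(w)$ the $C^1$ saddle branch, and $L_w,C_{\rm reg}>0$ the constants furnished by the implicit function theorem as described in the context, so that $\mathcal A_w(z^\star(w))=0$ on $U_{w^*}$, $\|z^\star(w_1)-z^\star(w_2)\|_Z\le L_w\|w_1-w_2\|_W$ for $w_1,w_2\in U_{w^*}$, and $\|z-z^\star(w)\|_Z\le C_{\rm reg}\|\mathcal A_w(z)\|_Z$ for $w\in U_{w^*}$, $z\in U_{z^*}$. Let $(w^n)_{n\ge0}$ and $(z^{n+1})_{n\ge0}$ be generated by the alternating scheme described in the context (inexact inner primal--dual solve with accepted output $z^{n+1}=(x^{n+1},y^{n+1})$, followed by $w^{n+1}=w^n-\tau_w\nabla_w\mathcal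 L(x^{n+1},y^{n+1},w^n)$), with $\varepsilon_n=\varepsilon_0(n+1)^{-(1+\delta)}$ for some $\varepsilon_0,\delta>0$. Suppose that $$w^n\in U_{w^*}\quad\text{and}\quad z^{n+1}\in U_{z^*}\qquad\text{for all }n\in\mathbb N,$$ that there is $C_{\rm est}>0$ independent of $n$ with $$\|\mathcal A_{w^n}(z^{n+1})\|_Z\le C_{\rm est}\,\varepsilon_n\qquad\text{for all }n\in\mathbb N,$$ that $\Psi$ is bounded from below on $U_{w^*}$, and that $0<\tau_w<1/L_\Psi$, where $L_\Psi$ is a Lipschitz constant of $\nabla\Psi$ on $U_{w^*}$. Then $$\sum_{n=0}^\infty\|w^{n+1}-w^n\|_W^2<\infty,\qquad \nabla\Psi(w^n)\to0,\qquad \|z^{n+1}-z^\star(w^n)\|_Z\le C_{\rm est}C_{\rm reg}\,\varepsilon_n\ \text{ for all }n.$$ Consequently, every accumulation point $\bar w$ of $(w^n)$ satisfies $\nabla\Psi(\bar w)=0$, and if $w^{n_j}\to\bar w$ along a subsequence, then $z^\star(w^{n_j})\to z^\star(\bar w)$ and $z^{n_j+1}\to z^\star(\bar w)$. Equivalently, every accumulation point $(\bar w,\bar z)$ of the sequence $(w^n,z^{n+1})$ satisfies $\bar z=z^\star(\bar w)$ and $\nabla\Psi(\bar w)=0$.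
   Context: $X,Y,W$ are finite-dimensional real Hilbert spaces, $Z=X\times Y$ with $\|z\|_Z^2=\|x\|_X^2+\|y\|_Y^2$ for $z=(x,y)$, and $$\mathcal L(x,y,w)=F(x)+\langle K(x,w),y\rangle_Y-G^\ast(y).$$ All gradients are Hilbert gradients. Fixed-$w$ optimality operator (where the derivatives exist), with $K_w:=K(\cdot,w)$: $$\mathcal A_w(x,y)=\begin{pmatrix}\nabla_x\mathcal L(x,y,w)\\-\nabla_y\mathcal L(x,y,w)\end{pmatrix}=\begin{pmatrix}\nabla F(x)+K_w^\ast y\\ \nabla G^\ast(y)-K_wx\end{pmatrix}.$$ Local branch: under the assumptions that $(w,z)\mapsto\mathcal A_w(z)$ is $C^1$ near $(w^\star,z^\star)$ and $D_z\mathcal A_{w^\star}(z^\star)$ is an isomorphism, by the implicit function theorem there are open bounded convex neighborhoods (balls) $U_{w^*}$ of $w^\star$ and $U_{z^*}$ of $z^\star$, a unique $C^1$ map $U_{w^*}\ni w\mapsto z^\star(w)=(x^\star(w),y^\star(w))\in U_{z^*}$, and constants $L_w,C_{\rm reg}>0$ with $\mathcal A_w(z^\star(w))=0$ on $U_{w^*}$, $\|z^\star(w_1)-z^\star(w_2)\|_Z\le L_w\|w_1-w_2\|_W$ for $w_1,w_2\in U_{w^*}$, and $\|z-z^\star(w)\|_Z\le C_{\rm reg}\|\mathcal A_w(z)\|_Z$ for $w\in U_{w^*}$, $z\in U_{z^*}$. The balls are chosen so that their closures stay inside the neighborhoods on which $\mathcal A$ is $C^1$ and the implicit-function branch is defined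 and $C^1$; thus $z^\star(\cdot)$ and $\Psi$ make sense also at points of $\overline{U_{w^*}}$. The reduced functional is $\Psi(w):=\mathcal L(x^\star(w),y^\star(w),w)$. Alternating scheme: given $w^n$, an inner primal--dual (Chambolle--Pock) iteration for $\min_x\max_y\mathcal L(x,y,w^n)$ with step sizes $\tau_x,\tau_y>0$, $\tau_x\tau_y\|K(\cdot,w^n)\|^2<1$, produces iterates $z^{n,j}=(x^{n,j},y^{n,j})$; one may take $x^{n,j+1}=\arg\min_x\{\mathcal L(x,2y^{n,j}-y^{n,j-1},w^n)+\frac1{2\tau_x}\|x-x^{n,j}\|_X^2\}$, $y^{n,j+1}=\arg\max_y\{\mathcal L(x^{n,j+1},y,w^n)-\frac1{2\tau_y}\|y-y^{n,j}\|_Y^2\}$. With $\mathrm{Res}_{n,j}:=\|z^{n,j}-z^{n,j-1}\|_Z$, one stops at a finite index $j_n$ with $\mathrm{Res}_{n,j_n}+\mathrm{Res}_{n,j_n-1}\le\varepsilon_n$ and sets $z^{n+1}=(x^{n+1},y^{n+1}):=z^{n,j_n}$ (accepted inner output). Then $w^{n+1}=w^n-\tau_w\nabla_w\mathcal L(x^{n+1},y^{n+1},w^n)$. *)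

theory Defs
  imports "HOL-Analysis.Analysis"
begin

section \<open>Extended-real convex analysis\<close>

definition proper_fun :: "('a \<Rightarrow> ereal) \<Rightarrow> bool" where
  "proper_fun f \<longleftrightarrow> (\<forall>x. f x \<noteq> -\<infinity>) \<and> (\<exists>x. f x \<noteq> \<infinity>)"

definition convex_fun :: "('a::real_vector \<Rightarrow> ereal) \<Rightarrow> bool" where
  "convex_fun f \<longleftrightarrow>
     (\<forall>x y. \<forall>t\<in>{0<..<1}. f ((1 - t) *\<^sub>R x + t *\<^sub>R y) \<le> ereal (1 - t) * f x + ereal t * f y)"

definition lsc_fun :: "('a::topological_space \<Rightarrow> ereal) \<Rightarrow> bool" where
  "lsc_fun f \<longleftrightarrow> (\<forall>x. f x \<le> Liminf (at x) f)"


section \<open>Smoothness and Hilbert gradients\<close>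

definition C1_on :: "'a set \<Rightarrow> ('a::real_normed_vector \<Rightarrow> 'b::real_normed_vector) \<Rightarrow> bool" where
  "C1_on S f \<longleftrightarrow> open S \<and>
     (\<exists>f' :: 'a \<Rightarrow> 'a \<Rightarrow>\<^sub>L 'b.
        (\<forall>x\<in>S. (f has_derivative blinfun_apply (f' x)) (at x)) \<and> continuous_on S f')"

definition C2_on :: "'a set \<Rightarrow> ('a::real_normed_vector \<Rightarrow> 'b::real_normed_vector) \<Rightarrow> bool" where
  "C2_on S f \<longleftrightarrow>
     (\<exists>f' :: 'a \<Rightarrow> 'a \<Rightarrow>\<^sub>L 'b.
        (\<forall>x\<in>S. (f has_derivative blinfun_apply (f' x)) (at x)) \<and> C1_on S f')"

definition finite_C2_on :: "'a set \<Rightarrow> ('a::real_normed_vector \<Rightarrow> ereal) \<Rightarrow> bool" where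
  "finite_C2_on S f \<longleftrightarrow> (\<forall>x\<in>S. \<bar>f x\<bar> \<noteq> \<infinity>) \<and> C2_on S (\<lambda>x. real_of_ereal (f x))"

text \<open>Meaningful only at points of differentiability; unspecified elsewhere.\<close>

definition grad :: "('a::real_inner \<Rightarrow> real) \<Rightarrow> 'a \<Rightarrow> 'a" where
  "grad f x = (THE g. GDERIV f x :> g)"

lemma GDERIV_unique:
  assumes "GDERIV f x :> g" "GDERIV f x :> h"
  shows "g = h"
proof -
  have "(\<lambda>v. inner v g) = (\<lambda>v. inner v h)"
    using assms unfolding gderiv_def by (rule has_derivative_unique)
  then have "inner (g - h) g = inner (g - h) h"
    by (rule fun_cong)
  then have "inner (g - h) (g - h) = 0"
    by (simp add: inner_diff_right)
  then show ?thesis by simp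
qed

lemma grad_eqI: "GDERIV f x :> g \<Longrightarrow> grad f x = g"
  unfolding grad_def by (rule the_equality) (auto intro: GDERIV_unique)


section \<open>The saddle problem\<close>

text \<open>
  In \<^typ>\<open>ereal\<close> one has \<open>\<infinity> - \<infinity> = \<infinity>\<close>, so the Lagrangian is \<open>\<infinity>\<close> where both \<open>F x = \<infinity>\<close>
  and \<open>Gs y = \<infinity>\<close>.  For proper \<open>F\<close> and \<open>Gs\<close>, a saddle point has both components in the
  effective domains whichever value is chosen there.
\<close>

definition Lag :: "('x::real_inner \<Rightarrow> ereal) \<Rightarrow> ('y::real_inner \<Rightarrow> ereal) \<Rightarrow> ('x \<Rightarrow> 'w \<Rightarrow> 'y)
    \<Rightarrow> 'x \<Rightarrow> 'y \<Rightarrow> 'w \<Rightarrow> ereal" where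
  "Lag F Gs K x y w = F x + ereal (inner (K x w) y) - Gs y"

definition saddle_point :: "('x::real_inner \<Rightarrow> ereal) \<Rightarrow> ('y::real_inner \<Rightarrow> ereal)
    \<Rightarrow> ('x \<Rightarrow> 'w \<Rightarrow> 'y) \<Rightarrow> 'w \<Rightarrow> 'x \<times> 'y \<Rightarrow> bool" where
  "saddle_point F Gs K w z \<longleftrightarrow>
     (\<forall>x y. Lag F Gs K (fst z) y w \<le> Lag F Gs K (fst z) (snd z) w \<and>
            Lag F Gs K (fst z) (snd z) w \<le> Lag F Gs K x (snd z) w)"

definition grad_x_Lag where
  "grad_x_Lag F Gs K x y w = grad (\<lambda>x'. real_of_ereal (Lag F Gs K x' y w)) x"

definition grad_y_Lag where
  "grad_y_Lag F Gs K x y w = grad (\<lambda>y'. real_of_ereal (Lag F Gs K x y' w)) y"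

definition grad_w_Lag where
  "grad_w_Lag F Gs K x y w = grad (\<lambda>w'. real_of_ereal (Lag F Gs K x y w')) w"

definition opt_op :: "('x::real_inner \<Rightarrow> ereal) \<Rightarrow> ('y::real_inner \<Rightarrow> ereal)
    \<Rightarrow> ('x \<Rightarrow> 'w \<Rightarrow> 'y) \<Rightarrow> 'w \<Rightarrow> 'x \<times> 'y \<Rightarrow> 'x \<times> 'y" where
  "opt_op F Gs K w z =
     (grad_x_Lag F Gs K (fst z) (snd z) w, - grad_y_Lag F Gs K (fst z) (snd z) w)"

lemma opt_op_eq:
  fixes F :: "'x::euclidean_space \<Rightarrow> ereal" and Gs :: "'y::euclidean_space \<Rightarrow> ereal"
  assumes S: "open S" "x \<in> S" "\<And>u. u \<in> S \<Longrightarrow> \<bar>F u\<bar> \<noteq> \<infinity>"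
    and T: "open T" "y \<in> T" "\<And>v. v \<in> T \<Longrightarrow> \<bar>Gs v\<bar> \<noteq> \<infinity>"
    and dF: "GDERIV (\<lambda>u. real_of_ereal (F u)) x :> gF"
    and dG: "GDERIV (\<lambda>v. real_of_ereal (Gs v)) y :> gG"
    and lin: "linear (\<lambda>u. K u w)"
  shows "opt_op F Gs K w (x, y) = (gF + adjoint (\<lambda>u. K u w) y, gG - K x w)"
proof -
  have eq: "real_of_ereal (Lag F Gs K u v w)
      = real_of_ereal (F u) + inner (K u w) v - real_of_ereal (Gs v)"
    if "u \<in> S" "v \<in> T" for u v
    using S(3)[OF that(1)] T(3)[OF that(2)]
    by (cases "F u"; cases "Gs v") (auto simp: Lag_def)
  have adj: "inner u (adjoint (\<lambda>u. K u w) y) = inner (K u w) y" for u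
    using adjoint_works[OF lin, of u y] by simp
  have bl: "((\<lambda>u. K u w) has_derivative (\<lambda>h. K h w)) (at x)"
    using lin by (rule linear_imp_has_derivative)
  have "((\<lambda>u. real_of_ereal (F u) + inner (K u w) y - real_of_ereal (Gs y))
          has_derivative (\<lambda>h. inner h (gF + adjoint (\<lambda>u. K u w) y))) (at x)"
    using dF unfolding gderiv_def
    by (auto intro!: derivative_eq_intros bl simp: inner_add_right adj)
  then have 1: "GDERIV (\<lambda>u. real_of_ereal (Lag F Gs K u y w)) x
      :> gF + adjoint (\<lambda>u. K u w) y"
    unfolding gderiv_def
    by (rule has_derivative_transform_within_open[OF _ S(1,2)]) (simp add: eq T(2))
  have "((\<lambda>v. real_of_ereal (F x) + inner (K x w) v - real_of_ereal (Gs v))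
          has_derivative (\<lambda>h. inner h (- (gG - K x w)))) (at y)"
    using dG unfolding gderiv_def
    by (auto intro!: derivative_eq_intros simp: inner_diff_right inner_commute)
  then have 2: "GDERIV (\<lambda>v. real_of_ereal (Lag F Gs K x v w)) y :> - (gG - K x w)"
    unfolding gderiv_def
    by (rule has_derivative_transform_within_open[OF _ T(1,2)]) (simp add: eq S(2))
  show ?thesis
    using grad_eqI[OF 1] grad_eqI[OF 2]
    by (simp add: opt_op_def grad_x_Lag_def grad_y_Lag_def)
qed


section \<open>The local branch and the reduced functional\<close>

text \<open>
  \<open>N\<close> is a neighbourhood of \<open>(ws, zst)\<close> on which \<open>(w, z) \<mapsto> opt_op F Gs K w z\<close> is \<open>C1\<close>.  The set
  \<open>V\<close> is the domain of the branch given by the implicit function theorem; its graph lies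
  in \<open>N\<close>, so that the branch and the reduced functional also make sense on the closure of \<open>Uw\<close>.
\<close>

definition local_branch :: "('x::euclidean_space \<Rightarrow> ereal) \<Rightarrow> ('y::euclidean_space \<Rightarrow> ereal)
    \<Rightarrow> ('x \<Rightarrow> 'w::euclidean_space \<Rightarrow> 'y) \<Rightarrow> ('w \<times> 'x \<times> 'y) set \<Rightarrow> 'w \<Rightarrow> 'x \<times> 'y
    \<Rightarrow> 'w set \<Rightarrow> ('x \<times> 'y) set \<Rightarrow> ('w \<Rightarrow> 'x \<times> 'y) \<Rightarrow> real \<Rightarrow> real \<Rightarrow> bool" where
  "local_branch F Gs K N ws zst Uw Uz zs Lw Creg \<longleftrightarrow>
     (\<exists>r>0. Uw = ball ws r) \<and> (\<exists>r>0. Uz = ball zst r) \<and>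
     closure Uw \<times> closure Uz \<subseteq> N \<and>
     (\<exists>V. closure Uw \<subseteq> V \<and> C1_on V zs \<and>
          (\<forall>w\<in>V. (w, zs w) \<in> N \<and> opt_op F Gs K w (zs w) = 0)) \<and>
     zs ` Uw \<subseteq> Uz \<and>
     (\<forall>w\<in>Uw. \<forall>z\<in>Uz. opt_op F Gs K w z = 0 \<longrightarrow> z = zs w) \<and>
     0 < Lw \<and> (\<forall>w1\<in>Uw. \<forall>w2\<in>Uw. norm (zs w1 - zs w2) \<le> Lw * norm (w1 - w2)) \<and>
     0 < Creg \<and> (\<forall>w\<in>Uw. \<forall>z\<in>Uz. norm (z - zs w) \<le> Creg * norm (opt_op F Gs K w z))"

definition reduced_fun :: "('x::real_inner \<Rightarrow> ereal) \<Rightarrow> ('y::real_inner \<Rightarrow> ereal)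
    \<Rightarrow> ('x \<Rightarrow> 'w \<Rightarrow> 'y) \<Rightarrow> ('w \<Rightarrow> 'x \<times> 'y) \<Rightarrow> 'w \<Rightarrow> real" where
  "reduced_fun F Gs K zs w = real_of_ereal (Lag F Gs K (fst (zs w)) (snd (zs w)) w)"


section \<open>The alternating scheme\<close>

text \<open>
  The first step extrapolates with the dual component of an (arbitrary) iterate with index \<open>-1\<close>;
  hence the integer index.  In the primal step the summand \<open>- Gs\<close> of the Lagrangian is omitted:
  it is constant in \<open>x\<close>, and it may be \<open>-\<infinity>\<close> at the extrapolated point, which need not lie in
  the domain of \<open>Gs\<close>.
\<close>

definition primal_dual_iter :: "('x::real_inner \<Rightarrow> ereal) \<Rightarrow> ('y::real_inner \<Rightarrow> ereal)
    \<Rightarrow> ('x \<Rightarrow> 'w \<Rightarrow> 'y) \<Rightarrow> real \<Rightarrow> real \<Rightarrow> 'w \<Rightarrow> (int \<Rightarrow> 'x \<times> 'y) \<Rightarrow> bool" where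
  "primal_dual_iter F Gs K \<tau>x \<tau>y w z \<longleftrightarrow>
     (\<forall>j\<ge>0.
        is_arg_min
          (\<lambda>x. F x + ereal (inner (K x w) (2 *\<^sub>R snd (z j) - snd (z (j - 1))))
                 + ereal (1 / (2 * \<tau>x) * (norm (x - fst (z j)))\<^sup>2))
          (\<lambda>x. True) (fst (z (j + 1))) \<and>
        is_arg_max
          (\<lambda>y. Lag F Gs K (fst (z (j + 1))) y w
                 - ereal (1 / (2 * \<tau>y) * (norm (y - snd (z j)))\<^sup>2))
          (\<lambda>y. True) (snd (z (j + 1))))"

definition Res :: "(int \<Rightarrow> 'z::real_normed_vector) \<Rightarrow> int \<Rightarrow> real" where
  "Res z j = norm (z j - z (j - 1))"

definition alternating_scheme :: "('x::euclidean_space \<Rightarrow> ereal) \<Rightarrow> ('y::euclidean_space \<Rightarrow> ereal)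
    \<Rightarrow> ('x \<Rightarrow> 'w::euclidean_space \<Rightarrow> 'y) \<Rightarrow> real \<Rightarrow> real \<Rightarrow> real \<Rightarrow> (nat \<Rightarrow> real)
    \<Rightarrow> (nat \<Rightarrow> 'w) \<Rightarrow> (nat \<Rightarrow> 'x \<times> 'y) \<Rightarrow> bool" where
  "alternating_scheme F Gs K \<tau>x \<tau>y \<tau>w \<epsilon> w z \<longleftrightarrow>
     0 < \<tau>x \<and> 0 < \<tau>y \<and>
     (\<forall>n. \<tau>x * \<tau>y * (onorm (\<lambda>x. K x (w n)))\<^sup>2 < 1 \<and>
          (\<exists>zi. primal_dual_iter F Gs K \<tau>x \<tau>y (w n) zi \<and>
                (\<exists>j\<ge>1. Res zi j + Res zi (j - 1) \<le> \<epsilon> n \<and> z (Suc n) = zi j)) \<and>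
          w (Suc n) = w n - \<tau>w *\<^sub>R grad_w_Lag F Gs K (fst (z (Suc n))) (snd (z (Suc n))) (w n))"

definition accumulation_point :: "(nat \<Rightarrow> 'a::topological_space) \<Rightarrow> 'a \<Rightarrow> bool" where
  "accumulation_point s a \<longleftrightarrow> (\<exists>r :: nat \<Rightarrow> nat. strict_mono r \<and> (\<lambda>j. s (r j)) \<longlonglongrightarrow> a)"

end

theory Submission
  imports Defs
begin

text \<open>
  Since the optimality operator vanishes along the branch, the chain rule leaves only the partial
  derivative in \<open>w\<close>: the gradient of the reduced functional at \<open>w\<close> is \<open>grad_w_Lag\<close> at the branch
  point, a bilinear expression in that point.  The outer step is therefore a gradient step for the
  reduced functional, with an error of at most a constant times the distance of the inner iterate
  to the branch, hence summable.  Summing the descent lemma over the steps, and estimating the term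
  linear in the error by means of the diameter of the ball, makes the squared increments summable.
\<close>

section \<open>Smoothness on open sets and the existence of gradients\<close>

lemma C1_on_imp_open: "C1_on S f \<Longrightarrow> open S"
  by (simp add: C1_on_def)

lemma C1_on_imp_differentiable: "C1_on S f \<Longrightarrow> x \<in> S \<Longrightarrow> f differentiable (at x)"
  unfolding C1_on_def differentiable_def by blast

lemma C1_on_imp_continuous_on: "C1_on S f \<Longrightarrow> continuous_on S f"
  by (meson C1_on_imp_differentiable continuous_at_imp_continuous_on
      differentiable_imp_continuous_within)

lemma finite_C2_on_imp_open: "finite_C2_on S f \<Longrightarrow> open S"
  unfolding finite_C2_on_def C2_on_def C1_on_def by blast

lemma finite_C2_on_imp_finite: "finite_C2_on S f \<Longrightarrow> x \<in> S \<Longrightarrow> \<bar>f x\<bar> \<noteq> \<infinity>"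
  by (simp add: finite_C2_on_def)

text \<open>Riesz representation in finite dimensions: a linear functional \<open>D\<close>
  satisfies \<open>D h = inner (D h) 1 = inner h (adjoint D 1)\<close>, so the vector
  \<open>adjoint D 1\<close> is the gradient.\<close>

lemma differentiable_imp_GDERIV:
  fixes f :: "'a::euclidean_space \<Rightarrow> real"
  assumes "f differentiable (at x)"
  obtains g where "GDERIV f x :> g"
proof -
  from assms obtain D where D: "(f has_derivative D) (at x)"
    unfolding differentiable_def by blast
  have "linear D"
    using D by (rule has_derivative_linear)
  then have "D = (\<lambda>h. inner h (adjoint D 1))"
    by (simp add: fun_eq_iff adjoint_works)
  with D have "GDERIV f x :> adjoint D 1"
    unfolding gderiv_def by simp
  then show thesis by (rule that)
qed

lemma finite_C2_on_imp_GDERIV: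
  fixes f :: "'a::euclidean_space \<Rightarrow> ereal"
  assumes "finite_C2_on S f" "x \<in> S"
  obtains g where "GDERIV (\<lambda>u. real_of_ereal (f u)) x :> g"
  using assms unfolding finite_C2_on_def C2_on_def
  by (metis differentiable_def differentiable_imp_GDERIV)

section \<open>The coupling term and the gradients in the outer variable\<close>

lemma bilinear_affine_part:
  fixes K :: "'x::euclidean_space \<Rightarrow> 'w::euclidean_space \<Rightarrow> 'y::euclidean_space"
  assumes "\<And>w. linear (\<lambda>x. K x w)" "\<And>x. linear (\<lambda>w. K x w - K x 0)"
  shows "bounded_bilinear (\<lambda>x w. K x w - K x 0)"
  using assms by (auto simp: bilinear_conv_bounded_bilinear[symmetric] bilinear_def linear_compose_sub)

text \<open>Testing against an arbitrary \<open>h\<close> turns \<open>adjoint (B x) y\<close> into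
  \<open>inner (B x h) y\<close>, which is additive and homogeneous in \<open>x\<close> and in
  \<open>y\<close>. With \<open>B\<close> the bilinear part of \<open>K\<close> this is the gradient
  in the outer variable; its bilinearity later gives both its continuity and its Lipschitz
  bound.\<close>

lemma bounded_bilinear_adjoint:
  fixes B :: "'x::euclidean_space \<Rightarrow> 'w::euclidean_space \<Rightarrow> 'y::euclidean_space"
  assumes "bounded_bilinear B"
  shows "bounded_bilinear (\<lambda>x y. adjoint (B x) y)"
proof -
  interpret B: bounded_bilinear B by fact
  have lin: "linear (B x)" for x
    by (simp add: B.bounded_linear_right bounded_linear.linear)
  have adj: "inner h (adjoint (B x) y) = inner (B x h) y" for h x y
    by (simp add: adjoint_works lin)
  have "bilinear (\<lambda>x y. adjoint (B x) y)"
    unfolding bilinear_def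
    by (intro conjI allI linearI)
       (simp_all add: vector_eq_ldot[symmetric] inner_add_right adj
         B.add_left B.scaleR_left B.add_right B.scaleR_right inner_add_left)
  then show ?thesis
    by (simp add: bilinear_conv_bounded_bilinear)
qed

lemma real_of_Lag:
  assumes "\<bar>F x\<bar> \<noteq> \<infinity>" "\<bar>Gs y\<bar> \<noteq> \<infinity>"
  shows "real_of_ereal (Lag F Gs K x y w)
    = real_of_ereal (F x) + inner (K x w) y - real_of_ereal (Gs y)"
  using assms by (cases "F x"; cases "Gs y") (auto simp: Lag_def)

text \<open>Only the coupling term varies with \<open>w\<close>, and it does so affinely. Hence the
  gradient is the same at every \<open>w\<close> and is determined by the primal-dual pair
  alone.\<close>

lemma grad_w_Lag_eq:
  fixes K :: "'x::euclidean_space \<Rightarrow> 'w::euclidean_space \<Rightarrow> 'y::euclidean_space"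
  assumes fin: "\<bar>F x\<bar> \<noteq> \<infinity>" "\<bar>Gs y\<bar> \<noteq> \<infinity>"
    and lin: "linear (\<lambda>w. K x w - K x 0)"
  shows "grad_w_Lag F Gs K x y w = adjoint (\<lambda>w. K x w - K x 0) y"
  unfolding grad_w_Lag_def
proof (rule grad_eqI)
  have "((\<lambda>w. (K x w - K x 0) + K x 0) has_derivative (\<lambda>h. K x h - K x 0)) (at w)"
    by (intro has_derivative_add_const linear_imp_has_derivative lin)
  then have "((\<lambda>w. K x w) has_derivative (\<lambda>h. K x h - K x 0)) (at w)"
    by simp
  then show "GDERIV (\<lambda>w. real_of_ereal (Lag F Gs K x y w)) w :> adjoint (\<lambda>w. K x w - K x 0) y"
    unfolding gderiv_def real_of_Lag[of F x Gs y K, OF fin]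
    by (auto intro!: derivative_eq_intros simp: adjoint_works[OF lin])
qed

text \<open>An envelope theorem: the point on the branch is stationary in \<open>x\<close> and
  \<open>y\<close>, so its motion with \<open>w\<close> has no first-order effect on the
  value.\<close>

lemma reduced_fun_GDERIV:
  fixes F :: "'x::euclidean_space \<Rightarrow> ereal" and Gs :: "'y::euclidean_space \<Rightarrow> ereal"
    and K :: "'x \<Rightarrow> 'w::euclidean_space \<Rightarrow> 'y"
  assumes lin: "\<And>w. linear (\<lambda>x. K x w)" "\<And>x. linear (\<lambda>w. K x w - K x 0)"
    and F: "finite_C2_on Nx F" and Gs: "finite_C2_on Ny Gs"
    and zs: "C1_on V zs" "zs ` V \<subseteq> Nx \<times> Ny"
    and opt: "opt_op F Gs K w (zs w) = 0" and w: "w \<in> V"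
  shows "GDERIV (reduced_fun F Gs K zs) w
    :> adjoint (\<lambda>h. K (fst (zs w)) h - K (fst (zs w)) 0) (snd (zs w))"
proof -
  define x y where "x = (\<lambda>w. fst (zs w))" and "y = (\<lambda>w. snd (zs w))"
  have x: "x v \<in> Nx" and y: "y v \<in> Ny" if "v \<in> V" for v
    using zs(2) that by (force simp: x_def y_def)+
  have red: "reduced_fun F Gs K zs v = real_of_ereal (Lag F Gs K (x v) (y v) v)" for v
    by (simp add: reduced_fun_def x_def y_def)
  interpret B: bounded_bilinear "\<lambda>x w. K x w - K x 0"
    by (rule bilinear_affine_part) (fact lin)+
  obtain Z where Z: "(zs has_derivative Z) (at w)"
    using C1_on_imp_differentiable[OF zs(1) w] by (auto simp: differentiable_def)
  define X Y where "X = (\<lambda>h. fst (Z h))" and "Y = (\<lambda>h. snd (Z h))"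
  have X: "(x has_derivative X) (at w)" and Y: "(y has_derivative Y) (at w)"
    using Z unfolding x_def y_def X_def Y_def
    by (auto intro: has_derivative_fst has_derivative_snd)
  obtain gF where gF: "GDERIV (\<lambda>u. real_of_ereal (F u)) (x w) :> gF"
    using finite_C2_on_imp_GDERIV[OF F x[OF w]] .
  obtain gG where gG: "GDERIV (\<lambda>v. real_of_ereal (Gs v)) (y w) :> gG"
    using finite_C2_on_imp_GDERIV[OF Gs y[OF w]] .
  have "opt_op F Gs K w (x w, y w)
      = (gF + adjoint (\<lambda>u. K u w) (y w), gG - K (x w) w)"
    using finite_C2_on_imp_open[OF F] x[OF w] finite_C2_on_imp_finite[OF F]
      finite_C2_on_imp_open[OF Gs] y[OF w] finite_C2_on_imp_finite[OF Gs] gF gG lin(1)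
    by (rule opt_op_eq)
  with opt have stat: "gF = - adjoint (\<lambda>u. K u w) (y w)" "gG = K (x w) w"
    by (auto simp: x_def y_def zero_prod_def eq_neg_iff_add_eq_0)
  have dF: "((\<lambda>v. real_of_ereal (F (x v))) has_derivative (\<lambda>h. inner (X h) gF)) (at w)"
    using has_derivative_compose[OF X gF[unfolded gderiv_def]] .
  have dG: "((\<lambda>v. real_of_ereal (Gs (y v))) has_derivative (\<lambda>h. inner (Y h) gG)) (at w)"
    using has_derivative_compose[OF Y gG[unfolded gderiv_def]] .
  \<comment> \<open>\<open>K (x v) v\<close> is the bilinear part at \<open>(x v, v)\<close> plus
    \<open>K (x v) 0\<close>. The product rule for the former yields a term
    \<open>- K (X h) 0\<close>, which the derivative of the latter cancels.\<close>
  have "((\<lambda>v. K (x v) 0) has_derivative (\<lambda>h. K (X h) 0)) (at w)"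
    using has_derivative_compose[OF X linear_imp_has_derivative[OF lin(1)]] .
  from has_derivative_add[OF B.FDERIV[OF X has_derivative_ident] this]
  have dK: "((\<lambda>v. K (x v) v) has_derivative (\<lambda>h. K (x w) h - K (x w) 0 + K (X h) w)) (at w)"
    by (simp add: algebra_simps)
  \<comment> \<open>By \<open>stat\<close>, the \<open>X h\<close> terms coming from
    \<open>F\<close> and from the coupling cancel, and so do the \<open>Y h\<close> terms coming
    from the coupling and from \<open>Gs\<close>.\<close>
  have "((\<lambda>v. real_of_ereal (F (x v)) + inner (K (x v) v) (y v) - real_of_ereal (Gs (y v)))
      has_derivative (\<lambda>h. inner h (adjoint (\<lambda>h. K (x w) h - K (x w) 0) (y w)))) (at w)"
    by (rule derivative_eq_intros dF dK Y dG refl)+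
       (simp add: fun_eq_iff stat adjoint_works[OF lin(1)] adjoint_works[OF lin(2)]
         inner_add_left inner_add_right inner_commute)
  \<comment> \<open>The extended-real value agrees with the real expression wherever
    \<open>F\<close> and \<open>Gs\<close> are finite along the branch, in particular on the open
    set \<open>V\<close> around \<open>w\<close>.\<close>
  then have "(reduced_fun F Gs K zs
      has_derivative (\<lambda>h. inner h (adjoint (\<lambda>h. K (x w) h - K (x w) 0) (y w)))) (at w)"
    by (rule has_derivative_transform_within_open[OF _ C1_on_imp_open[OF zs(1)] w])
       (use x y finite_C2_on_imp_finite[OF F] finite_C2_on_imp_finite[OF Gs] in
         \<open>simp add: red real_of_Lag\<close>)
  then show ?thesis
    by (simp add: gderiv_def x_def y_def)
qed

section \<open>Gradient descent with summable errors\<close>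

lemma descent_lemma:
  fixes f :: "'a::real_inner \<Rightarrow> real"
  assumes S: "convex S" "x \<in> S" "y \<in> S"
    and f: "\<And>u. u \<in> S \<Longrightarrow> GDERIV f u :> g u"
    and g: "L-lipschitz_on S g"
  shows "f y \<le> f x + inner (g x) (y - x) + L / 2 * (norm (y - x))\<^sup>2"
proof -
  define d where "d = y - x"
  \<comment> \<open>The gap between \<open>f\<close> on the segment and its quadratic upper model.
    The bound says that this gap is no larger at 1 than at 0; by Cauchy-Schwarz and the Lipschitz
    bound its derivative is nonpositive, so no integral is involved.\<close>
  define \<phi> where "\<phi> t = f (x + t *\<^sub>R d) - t * inner (g x) d - L / 2 * t\<^sup>2 * (norm d)\<^sup>2" for t
  define \<phi>' where "\<phi>' t = inner (g (x + t *\<^sub>R d)) d - inner (g x) d - L * t * (norm d)\<^sup>2" for t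
  have mem: "x + t *\<^sub>R d \<in> S" if "0 \<le> t" "t \<le> 1" for t
    using convexD_alt[OF S that] by (simp add: d_def algebra_simps)
  have "\<phi> 1 \<le> \<phi> 0"
  proof (rule DERIV_nonpos_imp_nonincreasing[where f = \<phi>])
    fix t :: real
    assume t: "0 \<le> t" "t \<le> 1"
    have "((\<lambda>t. x + t *\<^sub>R d) has_derivative (\<lambda>h. h *\<^sub>R d)) (at t)"
      by (auto intro!: derivative_eq_intros)
    from has_derivative_compose[OF this f[OF mem[OF t], unfolded gderiv_def]]
    have "((\<lambda>t. f (x + t *\<^sub>R d)) has_real_derivative inner (g (x + t *\<^sub>R d)) d) (at t)"
      unfolding has_field_derivative_def
      by (rule has_derivative_eq_rhs) (simp add: fun_eq_iff inner_commute mult.commute)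
    then have "(\<phi> has_real_derivative \<phi>' t) (at t)"
      unfolding \<phi>_def \<phi>'_def by (auto intro!: derivative_eq_intros)
    moreover have "\<phi>' t \<le> 0"
    proof -
      have "inner (g (x + t *\<^sub>R d) - g x) d \<le> norm (g (x + t *\<^sub>R d) - g x) * norm d"
        by (rule norm_cauchy_schwarz)
      also have "\<dots> \<le> (L * (t * norm d)) * norm d"
        using lipschitz_onD[OF g mem[OF t] S(2)] t
        by (intro mult_right_mono) (auto simp: dist_norm)
      finally show ?thesis
        by (simp add: \<phi>'_def inner_diff_left power2_eq_square mult.assoc)
    qed
    ultimately show "\<exists>l. (\<phi> has_real_derivative l) (at t) \<and> l \<le> 0"
      by blast
  qed simp
  then show ?thesis
    by (simp add: \<phi>_def d_def)
qed

text \<open>Summing the inequality telescopes \<open>u\<close>, which is bounded below, and the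
  partial sums of \<open>b\<close> stay below \<open>suminf b\<close>; so the partial sums of
  \<open>a\<close> are bounded.\<close>

lemma summable_of_descent:
  fixes a b u :: "nat \<Rightarrow> real"
  assumes step: "\<And>n. c * a n \<le> u n - u (Suc n) + b n"
    and c: "c > 0" and nonneg: "\<And>n. a n \<ge> 0" "\<And>n. b n \<ge> 0"
    and b: "summable b" and u: "\<And>n. m \<le> u n"
  shows "summable a"
proof (rule summableI_nonneg_bounded)
  fix n
  have "c * (\<Sum>k<n. a k) \<le> (\<Sum>k<n. (u k - u (Suc k)) + b k)"
    unfolding sum_distrib_left by (intro sum_mono step)
  also have "\<dots> = u 0 - u n + (\<Sum>k<n. b k)"
    by (simp add: sum.distrib sum_lessThan_telescope')
  also have "\<dots> \<le> u 0 - m + suminf b"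
    using u[of n] sum_le_suminf[OF b, of "{..<n}"] nonneg by fastforce
  finally show "(\<Sum>k<n. a k) \<le> (u 0 - m + suminf b) / c"
    using c by (simp add: field_simps)
qed (fact nonneg)

lemma inexact_gradient_descent:
  fixes f :: "'a::real_inner \<Rightarrow> real" and w e :: "nat \<Rightarrow> 'a"
  assumes S: "convex S" "bounded S" "bdd_below (f ` S)"
    and f: "\<And>u. u \<in> S \<Longrightarrow> GDERIV f u :> g u" and g: "L-lipschitz_on S g"
    and \<tau>: "0 < \<tau>" "\<tau> < 1 / L"
    and w: "\<And>n. w n \<in> S" "\<And>n. w (Suc n) = w n - \<tau> *\<^sub>R (g (w n) + e n)"
    and e: "summable (\<lambda>n. norm (e n))"
  shows "summable (\<lambda>n. (norm (w (Suc n) - w n))\<^sup>2)" "(\<lambda>n. g (w n)) \<longlonglongrightarrow> 0"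
proof -
  obtain m where m: "\<And>u. u \<in> S \<Longrightarrow> m \<le> f u"
    using S(3) by (auto simp: bdd_below_def)
  obtain R where R: "\<And>u. u \<in> S \<Longrightarrow> norm u \<le> R"
    using S(2) by (auto simp: bounded_iff)
  \<comment> \<open>As \<open>1 / 0 = 0\<close>, the bounds on \<open>\<tau>\<close> rule out
    \<open>L = 0\<close> as well as negative \<open>L\<close>.\<close>
  have "L > 0"
    using \<tau> by (smt (verit) zero_less_divide_1_iff)
  with \<tau> have "1 / \<tau> > L"
    by (simp add: field_simps)
  then have c: "1 / \<tau> - L / 2 > 0"
    using \<open>L > 0\<close> by linarith
  show sq: "summable (\<lambda>n. (norm (w (Suc n) - w n))\<^sup>2)"
  proof (rule summable_of_descent[OF _ c])
    fix n
    define d where "d = w (Suc n) - w n"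
    \<comment> \<open>The update solved for the gradient; its inner product with \<open>d\<close>
      supplies the decrease \<open>1 / \<tau>\<close>, of which the descent lemma takes back
      \<open>L / 2\<close>.\<close>
    have "g (w n) = - (1 / \<tau>) *\<^sub>R d - e n"
      using \<tau> by (simp add: d_def w(2))
    then have "inner (g (w n)) d = - (1 / \<tau>) * (norm d)\<^sup>2 - inner (e n) d"
      by (simp add: inner_diff_left power2_norm_eq_inner)
    moreover have "- inner (e n) d \<le> norm (e n) * norm d"
      using norm_cauchy_schwarz[of "- e n" d] by simp
    \<comment> \<open>Both iterates have norm at most \<open>R\<close>. The error thus enters
      linearly, which matches the summability of \<open>norm (e n)\<close>.\<close>
    moreover have "norm (e n) * norm d \<le> norm (e n) * (2 * R)"
      using norm_triangle_ineq4[of "w (Suc n)" "w n"] R[OF w(1), of n] R[OF w(1), of "Suc n"]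
      by (intro mult_left_mono) (auto simp: d_def)
    moreover have "f (w (Suc n)) \<le> f (w n) + inner (g (w n)) d + L / 2 * (norm d)\<^sup>2"
      unfolding d_def by (rule descent_lemma[OF S(1) w(1) w(1) f g])
    ultimately show "(1 / \<tau> - L / 2) * (norm (w (Suc n) - w n))\<^sup>2
        \<le> f (w n) - f (w (Suc n)) + norm (e n) * (2 * R)"
      unfolding d_def[symmetric] by (simp add: algebra_simps)
  next
    have "0 \<le> R"
      using R[OF w(1)] norm_ge_zero order_trans by blast
    then show "norm (e n) * (2 * R) \<ge> 0" for n
      by simp
    show "summable (\<lambda>n. norm (e n) * (2 * R))"
      using e by (rule summable_mult2)
    show "m \<le> f (w n)" for n
      by (rule m[OF w(1)])
  qed simp
  have "(\<lambda>n. w (Suc n) - w n) \<longlonglongrightarrow> 0"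
    using tendsto_real_sqrt[OF summable_LIMSEQ_zero[OF sq]] by (simp add: tendsto_norm_zero_iff)
  moreover have "e \<longlonglongrightarrow> 0"
    using summable_LIMSEQ_zero[OF e] by (simp add: tendsto_norm_zero_iff)
  \<comment> \<open>The gradient is again recovered from the update, now as a combination of two
    null sequences.\<close>
  ultimately have "(\<lambda>n. - (1 / \<tau>) *\<^sub>R (w (Suc n) - w n) - e n) \<longlonglongrightarrow> - (1 / \<tau>) *\<^sub>R 0 - 0"
    by (intro tendsto_intros)
  moreover have "- (1 / \<tau>) *\<^sub>R (w (Suc n) - w n) - e n = g (w n)" for n
    using \<tau> by (simp add: w(2))
  ultimately show "(\<lambda>n. g (w n)) \<longlonglongrightarrow> 0"
    by simp
qed

text \<open>Changing one argument at a time splits the difference into two terms, each at most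
  \<open>R * M\<close> times the distance. This converts the distance of an inner iterate to the
  branch into an error of the outer gradient.\<close>

lemma bounded_bilinear_lipschitz:
  fixes b :: "'a::real_normed_vector \<Rightarrow> 'b::real_normed_vector \<Rightarrow> 'c::real_normed_vector"
  assumes "bounded_bilinear b" "bounded S"
  obtains C where "C \<ge> 0"
    "\<And>z z'. z \<in> S \<Longrightarrow> z' \<in> S \<Longrightarrow> norm (b (fst z) (snd z) - b (fst z') (snd z')) \<le> C * norm (z - z')"
proof -
  interpret bounded_bilinear b by fact
  obtain M where M: "M > 0" "\<And>x y. norm (b x y) \<le> norm x * norm y * M"
    using pos_bounded by blast
  obtain R where R: "R > 0" "\<And>z. z \<in> S \<Longrightarrow> norm z \<le> R"
    using assms(2) by (auto simp: bounded_pos)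
  show thesis
  proof
    show "2 * R * M \<ge> 0" using M R by simp
    fix z z' assume z: "z \<in> S" "z' \<in> S"
    have norm_fst_le': "norm (fst v) \<le> norm v" and norm_snd_le': "norm (snd v) \<le> norm v"
      for v :: "'a \<times> 'b"
      by (cases v, simp add: norm_fst_le norm_snd_le)+
    have "b (fst z) (snd z) - b (fst z') (snd z')
        = b (fst z) (snd (z - z')) + b (fst (z - z')) (snd z')"
      by (simp add: diff_left diff_right)
    also have "norm \<dots> \<le> norm (fst z) * norm (snd (z - z')) * M + norm (fst (z - z')) * norm (snd z') * M"
      by (intro norm_triangle_mono M)
    also have "\<dots> \<le> R * norm (z - z') * M + norm (z - z') * R * M"
      using M R(1) norm_fst_le' norm_snd_le' order_trans[OF norm_fst_le' R(2)[OF z(1)]]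
        order_trans[OF norm_snd_le' R(2)[OF z(2)]]
      by (intro add_mono mult_right_mono mult_mono) (auto simp del: fst_diff snd_diff)
    finally show "norm (b (fst z) (snd z) - b (fst z') (snd z')) \<le> 2 * R * M * norm (z - z')"
      by (simp add: algebra_simps)
  qed
qed

section \<open>Convergence of the alternating scheme\<close>

theorem theorem6:
  fixes F :: "'x::euclidean_space \<Rightarrow> ereal"
    and Gs :: "'y::euclidean_space \<Rightarrow> ereal"
    and K :: "'x \<Rightarrow> 'w::euclidean_space \<Rightarrow> 'y"
    and ws :: 'w and zst :: "'x \<times> 'y"
    and Nx :: "'x set" and Ny :: "'y set" and N :: "('w \<times> 'x \<times> 'y) set"
    and Uw :: "'w set" and Uz :: "('x \<times> 'y) set" and zs :: "'w \<Rightarrow> 'x \<times> 'y"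
    and Lw Creg Cest L\<Psi> \<tau>x \<tau>y \<tau>w \<epsilon>0 \<delta> :: real
    and \<epsilon> :: "nat \<Rightarrow> real" and w :: "nat \<Rightarrow> 'w" and z :: "nat \<Rightarrow> 'x \<times> 'y"
  defines "\<Psi> \<equiv> reduced_fun F Gs K zs"
  assumes "proper_fun F" "convex_fun F" "lsc_fun F"
    and "proper_fun Gs" "convex_fun Gs" "lsc_fun Gs"
    and "C1_on UNIV (\<lambda>(x, w). K x w)"
    and "\<And>w. linear (\<lambda>x. K x w)"
    and "\<And>x. linear (\<lambda>w. K x w - K x 0)"
    and "\<And>w. \<exists>z. saddle_point F Gs K w z"
    and "saddle_point F Gs K ws zst"
    and "fst zst \<in> Nx" "finite_C2_on Nx F"
    and "snd zst \<in> Ny" "finite_C2_on Ny Gs"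
    and "(ws, zst) \<in> N" "N \<subseteq> UNIV \<times> (Nx \<times> Ny)" "C1_on N (\<lambda>(w, z). opt_op F Gs K w z)"
    and "\<exists>D. (opt_op F Gs K ws has_derivative D) (at zst) \<and> bij D"
    and "local_branch F Gs K N ws zst Uw Uz zs Lw Creg"
    and "\<epsilon>0 > 0" "\<delta> > 0" "\<And>n. \<epsilon> n = \<epsilon>0 * real (n + 1) powr (- (1 + \<delta>))"
    and "alternating_scheme F Gs K \<tau>x \<tau>y \<tau>w \<epsilon> w z"
    and "\<And>n. w n \<in> Uw" "\<And>n. z (Suc n) \<in> Uz"
    and "Cest > 0" "\<And>n. norm (opt_op F Gs K (w n) (z (Suc n))) \<le> Cest * \<epsilon> n"
    and "bdd_below (\<Psi> ` Uw)"
    and "L\<Psi>-lipschitz_on Uw (grad \<Psi>)"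
    and "0 < \<tau>w" "\<tau>w < 1 / L\<Psi>"
  shows "summable (\<lambda>n. (norm (w (Suc n) - w n))\<^sup>2)
    \<and> (\<lambda>n. grad \<Psi> (w n)) \<longlonglongrightarrow> 0
    \<and> (\<forall>n. norm (z (Suc n) - zs (w n)) \<le> Cest * Creg * \<epsilon> n)
    \<and> (\<forall>wb. accumulation_point w wb \<longrightarrow> GDERIV \<Psi> wb :> 0)
    \<and> (\<forall>r wb. strict_mono r \<and> (\<lambda>j. w (r j)) \<longlonglongrightarrow> wb \<longrightarrow>
          (\<lambda>j. zs (w (r j))) \<longlonglongrightarrow> zs wb \<and> (\<lambda>j. z (Suc (r j))) \<longlonglongrightarrow> zs wb)
    \<and> (\<forall>wb zb. accumulation_point (\<lambda>n. (w n, z (Suc n))) (wb, zb) \<longrightarrow>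
          zb = zs wb \<and> GDERIV \<Psi> wb :> 0)"
proof -
  note K_lin = assms(9) and K_aff = assms(10) and F = assms(14) and Gs = assms(16)
    and N = assms(18) and branch = assms(21)[unfolded local_branch_def]
    and \<epsilon> = assms(22-24) and scheme = assms(25)
    and w = assms(26) and z = assms(27) and Cest = assms(28,29) and bdd = assms(30)
    and lip = assms(31) and \<tau>w = assms(32,33)
  obtain r1 r2 where Uw: "Uw = ball ws r1" and Uz: "Uz = ball zst r2"
    using branch by (elim conjE exE) (rule that)
  \<comment> \<open>Limits of the outer iterates may lie on the boundary of \<open>Uw\<close>. On
    the open set \<open>V\<close>, which contains the closure, the branch is still differentiable
    and stationary.\<close>
  obtain V where V: "closure Uw \<subseteq> V" "C1_on V zs"
    "\<And>u. u \<in> V \<Longrightarrow> (u, zs u) \<in> N" "\<And>u. u \<in> V \<Longrightarrow> opt_op F Gs K u (zs u) = 0"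
    using branch by (elim conjE exE) (rule that, auto)
  have sub: "closure Uw \<times> closure Uz \<subseteq> N" and zs_Uz: "zs ` Uw \<subseteq> Uz" and Creg: "0 < Creg"
    "\<And>u v. u \<in> Uw \<Longrightarrow> v \<in> Uz \<Longrightarrow> norm (v - zs u) \<le> Creg * norm (opt_op F Gs K u v)"
    using branch by simp_all
  have Uw_V: "u \<in> V" if "u \<in> Uw" for u
    using that V(1) closure_subset by blast
  define b where "b x y = adjoint (\<lambda>h. K x h - K x 0) y" for x y
  have b: "bounded_bilinear b"
    unfolding b_def by (intro bounded_bilinear_adjoint bilinear_affine_part K_lin K_aff)
  have \<Psi>': "GDERIV \<Psi> u :> b (fst (zs u)) (snd (zs u))" if "u \<in> V" for u
    unfolding \<Psi>_def b_def
  proof (rule reduced_fun_GDERIV[OF K_lin K_aff F Gs V(2) _ V(4)[OF that] that])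
    show "zs ` V \<subseteq> Nx \<times> Ny"
      using V(3) N by blast
  qed
  have grad_eq: "grad \<Psi> u = b (fst (zs u)) (snd (zs u))" if "u \<in> V" for u
    using grad_eqI[OF \<Psi>'[OF that]] .
  have grad_w: "grad_w_Lag F Gs K (fst v) (snd v) u = b (fst v) (snd v)" if "v \<in> Uz" for u v
  proof -
    \<comment> \<open>\<open>w 0\<close> merely serves as some point of \<open>Uw\<close>: the
      inclusion in \<open>N\<close> is stated for pairs, and only its consequence for
      \<open>v\<close>, finiteness of \<open>F\<close> and \<open>Gs\<close> there, is of
      interest.\<close>
    have "(w 0, v) \<in> N"
      using subsetD[OF closure_subset w[of 0]] subsetD[OF closure_subset that]
      by (intro subsetD[OF sub]) simp
    then have "fst v \<in> Nx" "snd v \<in> Ny"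
      using N by auto
    then show ?thesis
      unfolding b_def
      by (intro grad_w_Lag_eq K_aff finite_C2_on_imp_finite[OF F] finite_C2_on_imp_finite[OF Gs])
  qed
  have zs_w: "zs (w n) \<in> Uz" for n
    using zs_Uz w by blast
  have dist: "norm (z (Suc n) - zs (w n)) \<le> Cest * Creg * \<epsilon> n" for n
  proof -
    have "norm (z (Suc n) - zs (w n)) \<le> Creg * norm (opt_op F Gs K (w n) (z (Suc n)))"
      by (rule Creg(2)[OF w z])
    also have "\<dots> \<le> Creg * (Cest * \<epsilon> n)"
      using Creg(1) Cest(2) by (intro mult_left_mono) auto
    finally show ?thesis by (simp add: mult_ac)
  qed
  \<comment> \<open>A p-series with exponent \<open>1 + \<delta> > 1\<close>. Its term at 0 is 0,
    and dropping it gives the index \<open>n + 1\<close> of the tolerances.\<close>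
  have "summable (\<lambda>n. real n powr (- (1 + \<delta>)))"
    using \<epsilon>(2) by (simp add: summable_real_powr_iff)
  then have "summable (\<lambda>n. real (n + 1) powr (- (1 + \<delta>)))"
    by (rule summable_ignore_initial_segment)
  then have sum_\<epsilon>: "summable \<epsilon>"
    unfolding \<epsilon>(3) by (rule summable_mult)
  have "bounded Uz"
    by (simp add: Uz)
  then obtain C where C: "C \<ge> 0" "\<And>u v. u \<in> Uz \<Longrightarrow> v \<in> Uz \<Longrightarrow>
      norm (b (fst u) (snd u) - b (fst v) (snd v)) \<le> C * norm (u - v)"
    using bounded_bilinear_lipschitz[OF b] by blast
  \<comment> \<open>The gradient in \<open>w\<close> at the accepted inner iterate minus the one at
    the exact saddle point. Both points lie in the bounded set \<open>Uz\<close>, so the constant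
    \<open>C\<close> applies.\<close>
  define e where "e n = b (fst (z (Suc n))) (snd (z (Suc n))) - grad \<Psi> (w n)" for n
  have "norm (e n) \<le> C * (Cest * Creg * \<epsilon> n)" for n
    unfolding e_def grad_eq[OF Uw_V[OF w]]
    by (rule order_trans[OF C(2)[OF z zs_w] mult_left_mono[OF dist C(1)]])
  then have "summable (\<lambda>n. norm (e n))"
    by (intro summable_comparison_test'[OF summable_mult[OF summable_mult[OF sum_\<epsilon>]], of 0]) simp
  moreover have "w (Suc n) = w n - \<tau>w *\<^sub>R (grad \<Psi> (w n) + e n)" for n
    using scheme grad_w[OF z] by (simp add: alternating_scheme_def e_def)
  moreover have "GDERIV \<Psi> u :> grad \<Psi> u" if "u \<in> Uw" for u
    using \<Psi>'[OF Uw_V[OF that]] grad_eq[OF Uw_V[OF that]] by simp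
  ultimately have sq: "summable (\<lambda>n. (norm (w (Suc n) - w n))\<^sup>2)"
    and grad0: "(\<lambda>n. grad \<Psi> (w n)) \<longlonglongrightarrow> 0"
    using inexact_gradient_descent[of Uw \<Psi> "grad \<Psi>" L\<Psi> \<tau>w w e] w bdd lip \<tau>w
    by (auto simp: Uw)
  have lim_V: "wb \<in> V" if "(\<lambda>j. w (r j)) \<longlonglongrightarrow> wb" for r :: "nat \<Rightarrow> nat" and wb
    using that w V(1) by (meson closure_sequential subsetD)
  have zs_lim: "(\<lambda>j. zs (w (r j))) \<longlonglongrightarrow> zs wb" if "(\<lambda>j. w (r j)) \<longlonglongrightarrow> wb"
    for r :: "nat \<Rightarrow> nat" and wb
    using C1_on_imp_continuous_on[OF V(2)] that lim_V[OF that] Uw_V[OF w]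
    by (intro continuous_on_tendsto_compose[of V zs]) auto
  \<comment> \<open>The limit is taken in the formula \<open>b (fst (zs u)) (snd (zs u))\<close>,
    which is continuous on all of \<open>V\<close>; hence boundary points of \<open>Uw\<close> are
    covered, with differentiability of \<open>\<Psi>\<close> there included.\<close>
  have stationary: "GDERIV \<Psi> wb :> 0" if r: "strict_mono r" "(\<lambda>j. w (r j)) \<longlonglongrightarrow> wb"
    for r :: "nat \<Rightarrow> nat" and wb
  proof -
    have "(\<lambda>j. b (fst (zs (w (r j)))) (snd (zs (w (r j))))) \<longlonglongrightarrow> b (fst (zs wb)) (snd (zs wb))"
      by (intro bounded_bilinear.tendsto[OF b] tendsto_fst tendsto_snd zs_lim r)
    moreover have "(\<lambda>j. b (fst (zs (w (r j)))) (snd (zs (w (r j))))) \<longlonglongrightarrow> 0"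
      using LIMSEQ_subseq_LIMSEQ[OF grad0 r(1)] by (simp add: o_def grad_eq[OF Uw_V[OF w]])
    ultimately have "b (fst (zs wb)) (snd (zs wb)) = 0"
      by (rule LIMSEQ_unique)
    then show ?thesis
      using \<Psi>'[OF lim_V[OF r(2)]] by simp
  qed
  have "(\<lambda>n. Cest * Creg * \<epsilon> n) \<longlonglongrightarrow> 0"
    by (rule summable_LIMSEQ_zero[OF summable_mult[OF sum_\<epsilon>]])
  then have diff0: "(\<lambda>n. z (Suc n) - zs (w n)) \<longlonglongrightarrow> 0"
    by (rule tendsto_0_le[where K = 1]) (use order_trans[OF dist abs_ge_self] in auto)
  have z_lim: "(\<lambda>j. z (Suc (r j))) \<longlonglongrightarrow> zs wb" if r: "strict_mono r" "(\<lambda>j. w (r j)) \<longlonglongrightarrow> wb"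
    for r :: "nat \<Rightarrow> nat" and wb
    using tendsto_add[OF LIMSEQ_subseq_LIMSEQ[OF diff0 r(1)] zs_lim[OF r(2)]] by (simp add: o_def)
  have "zb = zs wb \<and> GDERIV \<Psi> wb :> 0"
    if acc: "accumulation_point (\<lambda>n. (w n, z (Suc n))) (wb, zb)" for wb zb
  proof -
    \<comment> \<open>The subsequence for the pair also makes the outer iterates converge, so
      \<open>z_lim\<close> gives a second limit for the inner ones, and limits are unique.\<close>
    obtain r where r: "strict_mono r" and lim: "(\<lambda>j. (w (r j), z (Suc (r j)))) \<longlonglongrightarrow> (wb, zb)"
      using acc by (auto simp: accumulation_point_def)
    have lim_w: "(\<lambda>j. w (r j)) \<longlonglongrightarrow> wb" and lim_z: "(\<lambda>j. z (Suc (r j))) \<longlonglongrightarrow> zb"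
      using tendsto_fst[OF lim] tendsto_snd[OF lim] by simp_all
    show ?thesis
      using LIMSEQ_unique[OF lim_z z_lim[OF r lim_w]] stationary[OF r lim_w] by simp
  qed
  then show ?thesis
    using sq grad0 dist stationary zs_lim z_lim by (auto simp: accumulation_point_def)
qed

end
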